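(* Let $S \subseteq \mathbb{N}_0$ be nonempty and let $c_0, c_1 \in (0,1)$. For every real number $h > 0$, $Q(h) = 0$ if and only if $$\sum_{s \in S} c_0^{sh} c_1^{h} = 1,$$ where $Q(t) = \limsup_{n\to\infty} \frac1n \log\left(\sum_{\omega \in \mathcal{G}_n} c_\omega^t\right)$.
   Context: $\mathbb{N}_0 = \{0,1,2,\dots\}$. $c_0, c_1$ are the lower contraction constants of a hyperbolic iterated function system $\{\mathcal{K}; f_0,f_1\}$ (only the constants matter here). For a finite word $\omega = \omega_1\cdots\omega_n$ over $\{0,1\}$, $c_\omega = c_{\omega_1}\cdots c_{\omega_n}$. For $n \ge 1$, $\mathcal{G}_n$ is the set of words of length $n$ of the form $0^{s_1}1 0^{s_2} 1 \cdots 0^{s_k} 1$ with $k \ge 1$ and $s_i \in S$ for $1 \le i \le k$. Convention: $\log 0 = -\infty$ (when $\mathcal{G}_n = \emptyset$). *)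

theory Defs
  imports "HOL-Analysis.Analysis"
begin

definition word_const :: "(nat \<Rightarrow> real) \<Rightarrow> nat list \<Rightarrow> real" where
  "word_const c w = prod_list (map c w)"

definition block :: "nat \<Rightarrow> nat list" where
  "block s = replicate s 0 @ [1]"

definition G :: "nat set \<Rightarrow> nat \<Rightarrow> nat list set" where
  "G S n = {w. length w = n \<and> (\<exists>ss. ss \<noteq> [] \<and> set ss \<subseteq> S \<and> w = concat (map block ss))}"

text \<open>
  Words of \<open>G S n\<close> have length \<open>n\<close> and letters in \<open>{0,1}\<close>, so the finite sum over
  \<open>G S n\<close> below is never the default value of a sum over an infinite set.
\<close>

lemma finite_G: "finite (G S n)"
proof (rule finite_subset)
  show "G S n \<subseteq> {w. set w \<subseteq> {0, 1} \<and> length w = n}"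
    by (auto simp: G_def block_def)
  show "finite {w :: nat list. set w \<subseteq> {0, 1} \<and> length w = n}"
    by (rule finite_lists_length_eq) simp
qed

text \<open>
  Logarithm of a nonnegative real with the convention \<open>log 0 = -\<infinity>\<close>; the value at
  negative arguments, which do not occur, is irrelevant.
\<close>

definition elog :: "real \<Rightarrow> ereal" where
  "elog x = (if x = 0 then -\<infinity> else ereal (ln x))"

text \<open>
  The factor at \<open>n = 0\<close> is a junk value of division by zero, which the limit superior ignores.
\<close>

definition Q :: "(nat \<Rightarrow> real) \<Rightarrow> nat set \<Rightarrow> real \<Rightarrow> ereal" where
  "Q c S t = limsup (\<lambda>n. ereal (1 / real n) * elog (\<Sum>w\<in>G S n. word_const c w powr t))"

end

theory Submission
  imports Defs
begin

text \<open>
  Every nonempty concatenation of blocks \<open>0\<^sup>s1\<close> is uniquely a first block followed by a shorter,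
  possibly empty concatenation. Hence the sums \<open>u n = (\<Sum>w\<in>G S n. word_const c w powr h)\<close>,
  completed by \<open>u 0 = 1\<close>, form a renewal sequence: \<open>u (n + 1) = (\<Sum>s\<le>n. q s * u (n - s))\<close>, where
  \<open>q s = word_const c (block s) powr h\<close> for \<open>s \<in> S\<close> and \<open>0\<close> otherwise (\<open>weight_renewal\<close>).
  For \<open>x > 0\<close> the sequence \<open>u n * x ^ n\<close> is again a renewal sequence, now with step weights
  \<open>q s * x ^ (s + 1)\<close>; let \<open>F x\<close> be their sum.

  If \<open>F x \<le> 1\<close>, induction gives \<open>u n * x ^ n \<le> 1\<close>, so the exponential growth rate of \<open>u\<close> is at
  most \<open>- ln x\<close>. If \<open>F x \<ge> 1\<close>, then \<open>u n * x ^ n\<close> is not summable, since its sum \<open>V\<close> would be at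
  least \<open>1\<close> and satisfy \<open>V = 1 + F x * V\<close>; so the growth rate is at least \<open>- ln x\<close>.

  The sum in the theorem is \<open>F 1\<close>. If it equals \<open>1\<close>, both bounds at \<open>x = 1\<close> show that the growth
  rate is \<open>0\<close>. The block weights decay geometrically, so \<open>F\<close> is finite and continuous on a
  neighbourhood of \<open>1\<close>. Therefore \<open>F 1 < 1\<close> gives some \<open>x > 1\<close> with \<open>F x \<le> 1\<close>, hence a negative
  growth rate, and \<open>F 1 > 1\<close> gives some \<open>x < 1\<close> with \<open>F x \<ge> 1\<close>, hence a positive one.
\<close>

section \<open>Growth of renewal sequences\<close>

definition renewal :: "(nat \<Rightarrow> real) \<Rightarrow> (nat \<Rightarrow> real) \<Rightarrow> bool" where
  "renewal f v \<longleftrightarrow> (\<forall>s. 0 \<le> f s) \<and> v 0 = 1 \<and> (\<forall>n. v (Suc n) = (\<Sum>s\<le>n. f s * v (n - s)))"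

definition growth_rate :: "(nat \<Rightarrow> real) \<Rightarrow> ereal" where
  "growth_rate u = limsup (\<lambda>n. ereal (1 / real n) * elog (u n))"

lemma renewal_nonneg:
  assumes "renewal f v"
  shows "0 \<le> v n"
proof (induction n rule: less_induct)
  case (less n)
  show ?case
  proof (cases n)
    case 0
    then show ?thesis using assms by (simp add: renewal_def)
  next
    case (Suc m)
    have "0 \<le> (\<Sum>s\<le>m. f s * v (m - s))"
      using assms less Suc by (intro sum_nonneg mult_nonneg_nonneg) (auto simp: renewal_def)
    then show ?thesis using assms Suc by (simp add: renewal_def)
  qed
qed

text \<open>
  Each term is a combination of earlier terms whose weights add up to at most \<open>1\<close>.
\<close>

lemma renewal_le_one:
  assumes v: "renewal f v" and f: "summable f" "suminf f \<le> 1"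
  shows "v n \<le> 1"
proof (induction n rule: less_induct)
  case (less n)
  have f0: "0 \<le> f s" for s using v by (simp add: renewal_def)
  show ?case
  proof (cases n)
    case 0
    then show ?thesis using v by (simp add: renewal_def)
  next
    case (Suc m)
    have "v n = (\<Sum>s\<le>m. f s * v (m - s))"
      using v Suc by (simp add: renewal_def)
    also have "\<dots> \<le> (\<Sum>s\<le>m. f s)"
      using less Suc f0 by (intro sum_mono mult_left_le) auto
    also have "\<dots> \<le> suminf f"
      using f(1) f0 by (intro sum_le_suminf) auto
    finally show ?thesis using f(2) by simp
  qed
qed

text \<open>
  The renewal equation is a Cauchy product; summing it gives \<open>V - 1 = suminf f * V\<close> with \<open>V \<ge> 1\<close>,
  which forces \<open>suminf f < 1\<close>.
\<close>

lemma renewal_not_summable: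
  assumes v: "renewal f v" and f: "summable f" "1 \<le> suminf f"
  shows "\<not> summable v"
proof
  assume sv: "summable v"
  have f0: "0 \<le> f s" for s using v by (simp add: renewal_def)
  have v0: "0 \<le> v n" for n using renewal_nonneg[OF v] .
  have "(\<lambda>n. \<Sum>s\<le>n. f s * v (n - s)) sums (suminf f * suminf v)"
    using f(1) sv f0 v0 by (intro Cauchy_product_sums) auto
  then have "(\<lambda>n. v (Suc n)) sums (suminf f * suminf v)"
    using v by (simp add: renewal_def)
  then have "suminf f * suminf v = suminf v - 1"
    using suminf_split_head[OF sv] v by (simp add: sums_iff renewal_def)
  moreover have "suminf v \<le> suminf f * suminf v"
    using mult_right_mono[OF f(2) suminf_nonneg[OF sv v0]] by simp
  ultimately show False by simp
qed

lemma renewal_scale: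
  assumes "renewal q u" and "0 < x"
  shows "renewal (\<lambda>s. q s * x ^ Suc s) (\<lambda>n. u n * x ^ n)"
proof -
  have "u (Suc n) * x ^ Suc n = (\<Sum>s\<le>n. q s * x ^ Suc s * (u (n - s) * x ^ (n - s)))" for n
  proof -
    have "u (Suc n) * x ^ Suc n = (\<Sum>s\<le>n. q s * u (n - s) * x ^ Suc n)"
      using assms by (simp only: renewal_def sum_distrib_right)
    also have "\<dots> = (\<Sum>s\<le>n. q s * x ^ Suc s * (u (n - s) * x ^ (n - s)))"
    proof (rule sum.cong)
      fix s assume "s \<in> {..n}"
      then have "x ^ Suc n = x ^ Suc s * x ^ (n - s)"
        by (simp flip: power_add)
      then show "q s * u (n - s) * x ^ Suc n = q s * x ^ Suc s * (u (n - s) * x ^ (n - s))"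
        by (simp only: mult_ac)
    qed simp
    finally show ?thesis .
  qed
  then show ?thesis using assms by (auto simp: renewal_def)
qed

lemma growth_rate_le:
  assumes u: "renewal q u" and x: "0 < x"
    and f: "summable (\<lambda>s. q s * x ^ Suc s)" "(\<Sum>s. q s * x ^ Suc s) \<le> 1"
  shows "growth_rate u \<le> ereal (- ln x)"
  unfolding growth_rate_def
proof (rule Limsup_bounded)
  have "ereal (1 / real n) * elog (u n) \<le> ereal (- ln x)" if n: "n > 0" for n
  proof (cases "u n = 0")
    case True
    then show ?thesis using n by (simp add: elog_def)
  next
    case False
    then have un: "0 < u n" using renewal_nonneg[OF u, of n] by simp
    have "u n * x ^ n \<le> 1"
      using renewal_le_one[OF renewal_scale[OF u x] f] .
    then have "ln (u n * x ^ n) \<le> 0"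
      using un x by simp
    then have "ln (u n) \<le> - (real n * ln x)"
      using un x by (simp add: ln_mult ln_realpow)
    then show ?thesis
      using n un by (simp add: elog_def field_simps)
  qed
  then show "\<forall>\<^sub>F n in sequentially. ereal (1 / real n) * elog (u n) \<le> ereal (- ln x)"
    by (rule eventually_mono[OF eventually_gt_at_top[of 0]])
qed

lemma growth_rate_ge:
  assumes u: "renewal q u" and x: "0 < x"
    and f: "summable (\<lambda>s. q s * x ^ Suc s)" "1 \<le> (\<Sum>s. q s * x ^ Suc s)"
  shows "ereal (- ln x) \<le> growth_rate u"
proof (rule ccontr)
  assume "\<not> ?thesis"
  \<comment> \<open>A growth rate below \<open>y < - ln x\<close> would bound \<open>u n * x ^ n\<close> by a convergent geometric series.\<close>
  then obtain y where y: "growth_rate u < ereal y" "y < - ln x"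
    using ereal_dense2[of "growth_rate u" "ereal (- ln x)"] by (auto simp: not_le)
  have "\<forall>\<^sub>F n in sequentially. ereal (1 / real n) * elog (u n) < ereal y"
    using y(1) unfolding growth_rate_def by (rule Limsup_lessD)
  then have "\<forall>\<^sub>F n in sequentially. norm (u n * x ^ n) \<le> (x * exp y) ^ n"
    using eventually_gt_at_top[of 0]
  proof eventually_elim
    case (elim n)
    have "u n \<le> exp y ^ n"
    proof (cases "u n = 0")
      case False
      then have un: "0 < u n" using renewal_nonneg[OF u, of n] by simp
      have "ln (u n) \<le> real n * y"
        using elim un by (simp add: elog_def field_simps)
      then have "exp (ln (u n)) \<le> exp (real n * y)" by simp
      then show ?thesis using un by (simp add: exp_of_nat_mult)
    qed simp
    then show ?case
      using x renewal_nonneg[OF u, of n]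
      by (simp add: abs_mult power_mult_distrib mult.commute mult_left_mono)
  qed
  moreover have "summable (\<lambda>n. (x * exp y) ^ n)"
  proof (rule summable_geometric)
    have "exp y < exp (- ln x)" using y(2) by simp
    then show "norm (x * exp y) < 1"
      using x by (simp add: exp_minus field_simps abs_mult)
  qed
  ultimately have "summable (\<lambda>n. u n * x ^ n)"
    by (rule summable_comparison_test_ev)
  then show False
    using renewal_not_summable[OF renewal_scale[OF u x] f] by simp
qed

text \<open>
  The geometric decay of \<open>q\<close> is what makes the generating function continuous at \<open>1\<close>.
  A strict inequality for its value there then persists at points on either side of \<open>1\<close>,
  where the growth bounds are strict.
\<close>

lemma growth_rate_eq_0_iff:
  assumes u: "renewal q u" and q: "\<And>s. q s \<le> b * a ^ s" and a: "0 < a" "a < 1"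
  shows "growth_rate u = 0 \<longleftrightarrow> suminf q = 1"
proof -
  have q0: "0 \<le> q s" for s using u by (simp add: renewal_def)
  define K where "K = (1 + 1 / a) / 2"
  have K: "1 < K" "a * K < 1"
    using a by (auto simp: K_def field_simps)
  have "summable (\<lambda>s. b * (a * K) ^ s)"
    using K a by (intro summable_mult summable_geometric) (auto simp: abs_mult)
  then have sK: "summable (\<lambda>s. q s * K ^ s)"
  proof (rule summable_comparison_test')
    show "norm (q s * K ^ s) \<le> b * (a * K) ^ s" for s
      using mult_right_mono[OF q[of s], of "K ^ s"] q0[of s] K
      by (simp add: power_mult_distrib mult_ac)
  qed
  define F where "F x = x * (\<Sum>s. q s * x ^ s)" for x
  have sF: "(\<lambda>s. q s * x ^ Suc s) sums F x" if "\<bar>x\<bar> < K" for x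
  proof -
    have "summable (\<lambda>s. q s * x ^ s)"
      using powser_inside[OF sK, of x] that by simp
    then show ?thesis
      unfolding F_def using sums_mult[OF summable_sums, of _ x] by (simp add: mult_ac)
  qed
  have F1: "F 1 = suminf q" by (simp add: F_def)
  have "isCont (\<lambda>x. \<Sum>s. q s * x ^ s) 1"
    using isCont_powser[OF sK, of 1] K by simp
  then have "isCont F 1"
    unfolding F_def by (intro continuous_intros)
  then have lim: "(F \<longlongrightarrow> F 1) (at 1)" by (simp add: isCont_def)
  have upper: "growth_rate u \<le> ereal (- ln x)" if "0 < x" "x < K" "F x \<le> 1" for x
    using growth_rate_le[OF u, of x] sF[of x] that by (auto simp: sums_iff)
  have lower: "ereal (- ln x) \<le> growth_rate u" if "0 < x" "x < K" "1 \<le> F x" for x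
    using growth_rate_ge[OF u, of x] sF[of x] that by (auto simp: sums_iff)
  consider "F 1 = 1" | "F 1 < 1" | "F 1 > 1" by linarith
  then show ?thesis
  proof cases
    case 1
    then have "growth_rate u \<le> 0" "0 \<le> growth_rate u"
      using upper[of 1] lower[of 1] K by (simp_all flip: zero_ereal_def)
    then show ?thesis using 1 F1 by simp
  next
    case 2
    then obtain d where d: "d > 0" "\<And>x. x \<noteq> 1 \<Longrightarrow> dist x 1 < d \<Longrightarrow> F x < 1"
      using order_tendstoD(2)[OF lim 2] by (auto simp: eventually_at)
    define x where "x = 1 + min d (K - 1) / 2"
    have x: "1 < x" "x < K" "F x < 1"
      using d(1) K d(2)[of x] by (auto simp: x_def dist_real_def min_def field_simps)
    then have "growth_rate u \<le> ereal (- ln x)" "ereal (- ln x) < 0"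
      using upper[of x] by auto
    then have "growth_rate u < 0" by (rule le_less_trans)
    then show ?thesis using 2 F1 by auto
  next
    case 3
    then obtain d where d: "d > 0" "\<And>x. x \<noteq> 1 \<Longrightarrow> dist x 1 < d \<Longrightarrow> 1 < F x"
      using order_tendstoD(1)[OF lim 3] by (auto simp: eventually_at)
    define x where "x = 1 - min d 1 / 2"
    have x: "0 < x" "x < 1" "1 < F x"
      using d(1) d(2)[of x] by (auto simp: x_def dist_real_def min_def field_simps)
    then have "0 < ereal (- ln x)" "ereal (- ln x) \<le> growth_rate u"
      using lower[of x] K by auto
    then have "0 < growth_rate u" by (rule less_le_trans)
    then show ?thesis using 3 F1 by auto
  qed
qed

section \<open>Unique decomposition into blocks\<close>

text \<open>
  Unlike \<open>G S n\<close>, this admits the empty concatenation, so that the remainder of a word after its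
  first block is again in the family; the two sets differ only at \<open>n = 0\<close>.
\<close>

definition block_words :: "nat set \<Rightarrow> nat \<Rightarrow> nat list set" where
  "block_words S n = {w. length w = n \<and> (\<exists>ss. set ss \<subseteq> S \<and> w = concat (map block ss))}"

lemma block_words_0: "block_words S 0 = {[]}"
  by (auto simp: block_words_def intro: exI[of _ "[]"])

lemma G_eq_block_words:
  assumes "0 < n"
  shows "G S n = block_words S n"
proof -
  have "ss \<noteq> []" if "length (concat (map block ss)) = n" for ss
    using that assms by auto
  then show ?thesis unfolding G_def block_words_def by blast
qed

lemma length_block [simp]: "length (block s) = Suc s"
  by (simp add: block_def)

text \<open>
  The first block is recovered from a word by its initial run of zeros.
\<close>

lemma block_append_inject [simp]: "block s @ w = block s' @ w' \<longleftrightarrow> s = s' \<and> w = w'"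
proof
  assume eq: "block s @ w = block s' @ w'"
  have run: "takeWhile (\<lambda>a. a = 0) (block r @ v) = replicate r 0" for r v
    by (induction r) (auto simp: block_def)
  have "replicate s (0 :: nat) = replicate s' 0"
    using run[of s w] run[of s' w'] eq by simp
  then have "s = s'" by simp
  with eq show "s = s' \<and> w = w'" by simp
qed auto

lemma bij_betw_first_block:
  "bij_betw (\<lambda>(s, w). block s @ w) (SIGMA s:S \<inter> {..n}. block_words S (n - s))
     (block_words S (Suc n))"
proof (intro bij_betw_imageI inj_onI)
  show "(\<lambda>(s, w). block s @ w) ` (SIGMA s:S \<inter> {..n}. block_words S (n - s)) =
    block_words S (Suc n)" (is "?f ` ?A = ?B")
  proof (intro equalityI subsetI)
    fix w assume "w \<in> ?f ` ?A"
    then obtain s v where w: "w = block s @ v" "s \<in> S" "s \<le> n" "v \<in> block_words S (n - s)"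
      by auto
    then obtain ss where ss: "set ss \<subseteq> S" "v = concat (map block ss)" "length v = n - s"
      by (auto simp: block_words_def)
    have "set (s # ss) \<subseteq> S \<and> w = concat (map block (s # ss))"
      using w(1,2) ss by simp
    moreover have "length w = Suc n"
      using w(1,3) ss by simp
    ultimately show "w \<in> ?B" unfolding block_words_def by blast
  next
    fix w assume "w \<in> ?B"
    then obtain ss where ss: "length w = Suc n" "set ss \<subseteq> S" "w = concat (map block ss)"
      by (auto simp: block_words_def)
    then obtain s rs where rs: "ss = s # rs" by (cases ss) auto
    let ?v = "concat (map block rs)"
    have w: "w = block s @ ?v" "s \<in> S" "s \<le> n" "length ?v = n - s" "set rs \<subseteq> S"
      using ss rs by auto
    then have "?v \<in> block_words S (n - s)" unfolding block_words_def by blast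
    with w have "(s, ?v) \<in> ?A" by simp
    then show "w \<in> ?f ` ?A" using w(1) by force
  qed
qed auto

section \<open>The weight sums as a renewal sequence\<close>

lemma word_const_block_append:
  "word_const c (block s @ w) = c 0 ^ s * c 1 * word_const c w"
  by (simp add: word_const_def block_def prod_list_replicate)

lemma weight_renewal:
  fixes c :: "nat \<Rightarrow> real"
  assumes c: "0 < c 0" "0 < c 1"
  shows "renewal (\<lambda>s. if s \<in> S then c 0 powr (real s * t) * c 1 powr t else 0)
           (\<lambda>n. \<Sum>w\<in>block_words S n. word_const c w powr t)"
    (is "renewal ?q ?u")
proof -
  have weight: "word_const c (block s @ w) powr t =
      c 0 powr (real s * t) * c 1 powr t * word_const c w powr t" for s w
    using c by (simp add: word_const_block_append powr_mult powr_powr flip: powr_realpow)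
  have fin: "finite (block_words S n)" for n
    by (cases n) (simp_all add: block_words_0 finite_G flip: G_eq_block_words)
  have "?u (Suc n) = (\<Sum>s\<le>n. ?q s * ?u (n - s))" for n
  proof -
    have "?u (Suc n) =
        (\<Sum>(s, w)\<in>(SIGMA s:S \<inter> {..n}. block_words S (n - s)). word_const c (block s @ w) powr t)"
      by (subst sum.reindex_bij_betw[OF bij_betw_first_block, symmetric])
        (simp add: case_prod_unfold)
    also have "\<dots> = (\<Sum>s\<in>S \<inter> {..n}. \<Sum>w\<in>block_words S (n - s). word_const c (block s @ w) powr t)"
      using fin by (subst sum.Sigma) auto
    also have "\<dots> = (\<Sum>s\<in>S \<inter> {..n}. ?q s * ?u (n - s))"
      by (intro sum.cong) (simp_all add: weight sum_distrib_left)
    also have "\<dots> = (\<Sum>s\<le>n. ?q s * ?u (n - s))"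
      by (rule sum.mono_neutral_left) auto
    finally show ?thesis .
  qed
  then show ?thesis
    by (simp add: renewal_def block_words_0 word_const_def)
qed

lemma Q_eq_growth_rate:
  "Q c S t = growth_rate (\<lambda>n. \<Sum>w\<in>block_words S n. word_const c w powr t)"
  unfolding Q_def growth_rate_def
  by (intro Limsup_eq eventually_mono[OF eventually_gt_at_top[of 0]]) (simp add: G_eq_block_words)

theorem proposition3p9:
  fixes S :: "nat set" and c :: "nat \<Rightarrow> real" and h :: real
  assumes "S \<noteq> {}"
    and "0 < c 0" "c 0 < 1"
    and "0 < c 1" "c 1 < 1"
    and "h > 0"
  shows "Q c S h = 0 \<longleftrightarrow> (\<Sum>\<^sub>\<infinity>s\<in>S. c 0 powr (real s * h) * c 1 powr h) = 1"
proof -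
  define p where "p s = c 0 powr (real s * h) * c 1 powr h" for s :: nat
  define q where "q = (\<lambda>s. if s \<in> S then p s else 0)"
  have a: "0 < c 0 powr h" "c 0 powr h < 1"
    using assms powr_less_mono2[of h "c 0" 1] by auto
  have p: "p s = c 1 powr h * (c 0 powr h) ^ s" for s
    using assms by (simp add: p_def powr_powr mult.commute flip: powr_realpow)
  have q: "0 \<le> q s" "q s \<le> c 1 powr h * (c 0 powr h) ^ s" for s
    by (simp_all add: q_def p)
  have "renewal q (\<lambda>n. \<Sum>w\<in>block_words S n. word_const c w powr h)"
    using weight_renewal[OF assms(2,4), of S h] unfolding q_def p_def .
  then have main: "Q c S h = 0 \<longleftrightarrow> suminf q = 1"
    unfolding Q_eq_growth_rate using q(2) a by (rule growth_rate_eq_0_iff)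
  have "summable (\<lambda>s. c 1 powr h * (c 0 powr h) ^ s)"
    using a by (intro summable_mult summable_geometric) simp
  then have "summable (\<lambda>s. norm (q s))"
    by (rule summable_comparison_test') (use q in auto)
  then have "(q has_sum suminf q) UNIV"
    using norm_summable_imp_has_sum summable_sums[OF summable_norm_cancel] by blast
  then have "suminf q = infsum q UNIV"
    by (rule infsumI[symmetric])
  also have "\<dots> = infsum p S"
    by (rule infsum_cong_neutral) (auto simp: q_def)
  finally show ?thesis using main by (simp add: p_def[abs_def])
qed

end
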